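(* Let $V$ and $H$ be real Hilbert spaces and let $A : V \to H$ be a bounded injective linear operator. Let $\delta > 0$ and let $g^\delta \in H$ be such that $$\|g_\perp^\delta\|_H < \delta < \|g^\delta\|_H,$$ where $g_\perp^\delta$ is the orthogonal projection of $g^\delta$ on $(\mathrm{Range}\, A)^\perp$. For $\varepsilon > 0$, let $u_\varepsilon^\delta \in V$ be the unique solution of $$(Au_\varepsilon^\delta, Av)_H + \varepsilon (u_\varepsilon^\delta, v)_V = (g^\delta, Av)_H, \quad \forall v \in V.$$ Then there exists a unique $\varepsilon > 0$ such that $\|Au_\varepsilon^\delta - g^\delta\|_H = \delta$.
   Context: $(\cdot,\cdot)_V$ and $(\cdot,\cdot)_H$ are the scalar products of $V$ and $H$, with norms $\|\cdot\|_V$ and $\|\cdot\|_H$. The range of $A$ is not assumed to be closed or dense in $H$. $(\mathrm{Range}\, A)^\perp$ is the orthogonal complement of $\mathrm{Range}\, A$ in $H$. The function $u_\varepsilon^\delta$ is the Tikhonov regularized solution associated with the data $g^\delta$. *)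

theory Defs
  imports "HOL-Analysis.Analysis"
begin

text \<open>The library's \<open>closest_point\<close> requires a Heine--Borel (finite-dimensional) space, so the
  orthogonal projection onto a closed subspace of a Hilbert space is introduced here; it is well
  defined by \<open>orth_proj_ex1\<close> (an orthogonal complement is closed by \<open>closed_orthogonal_comp\<close>).\<close>

definition orth_proj :: "'a::real_inner set \<Rightarrow> 'a \<Rightarrow> 'a" where
  "orth_proj S x = (THE p. p \<in> S \<and> x - p \<in> S\<^sup>\<bottom>)"

text \<open>For \<open>\<epsilon> > 0\<close> the defining problem is uniquely solvable by \<open>tikhonov_ex1\<close>; for other \<open>\<epsilon>\<close> the
  value is irrelevant.\<close>

definition tikhonov ::
  "('v::real_inner \<Rightarrow> 'h::real_inner) \<Rightarrow> 'h \<Rightarrow> real \<Rightarrow> 'v" where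
  "tikhonov A g \<epsilon> = (THE u. \<forall>v. A u \<bullet> A v + \<epsilon> * (u \<bullet> v) = g \<bullet> A v)"

lemma orth_proj_ex1:
  fixes S :: "'a::{real_inner,complete_space} set"
  assumes sub: "subspace S" and cl: "closed S"
  shows "\<exists>!p. p \<in> S \<and> x - p \<in> S\<^sup>\<bottom>"
proof -
  define d where "d = infdist x S"
  have ne: "S \<noteq> {}" using subspace_0[OF sub] by auto
  have d0: "d \<ge> 0" by (simp add: d_def infdist_nonneg)
  have dle: "d \<le> norm (x - y)" if "y \<in> S" for y
    using infdist_le[OF that, of x] by (simp add: d_def dist_norm)
  have dle2: "d\<^sup>2 \<le> (norm (x - y))\<^sup>2" if "y \<in> S" for y
    using dle[OF that] d0 by (simp add: power_mono)
  have "\<exists>y\<in>S. (norm (x - y))\<^sup>2 < d\<^sup>2 + 1 / real (Suc n)" for n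
  proof -
    have "sqrt (d\<^sup>2) < sqrt (d\<^sup>2 + 1 / real (Suc n))"
      by (rule real_sqrt_less_mono) simp
    then have "infdist x S < sqrt (d\<^sup>2 + 1 / real (Suc n))"
      using d0 by (simp add: d_def)
    then have "\<exists>y\<in>S. dist x y < sqrt (d\<^sup>2 + 1 / real (Suc n))"
      using ne by (simp add: infdist_def cInf_less_iff bdd_below_image_dist)
    then obtain y where y: "y \<in> S" "norm (x - y) < sqrt (d\<^sup>2 + 1 / real (Suc n))"
      by (auto simp: dist_norm)
    have "(norm (x - y))\<^sup>2 < (sqrt (d\<^sup>2 + 1 / real (Suc n)))\<^sup>2"
      using y(2) by (intro power_strict_mono) auto
    also have "\<dots> = d\<^sup>2 + 1 / real (Suc n)" by (rule real_sqrt_pow2) (simp add: add_nonneg_nonneg)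
    finally show ?thesis using y(1) by blast
  qed
  then obtain y where yS: "\<And>n. y n \<in> S"
    and yd: "\<And>n. (norm (x - y n))\<^sup>2 < d\<^sup>2 + 1 / real (Suc n)" by metis
  have para: "(norm (y m - y n))\<^sup>2 \<le> 2 / real (Suc m) + 2 / real (Suc n)" for m n
  proof -
    have mid: "(1/2) *\<^sub>R (y m + y n) \<in> S"
      using sub yS by (simp add: subspace_add subspace_scale)
    have "(norm (y m - y n))\<^sup>2 = 2 * (norm (x - y m))\<^sup>2 + 2 * (norm (x - y n))\<^sup>2
        - 4 * (norm (x - (1/2) *\<^sub>R (y m + y n)))\<^sup>2"
      unfolding power2_norm_eq_inner
      by (simp add: inner_diff_left inner_diff_right inner_add_left inner_add_right
          inner_commute algebra_simps)
    then show ?thesis using dle2[OF mid] yd[of m] yd[of n] by simp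
  qed
  have "Cauchy y"
  proof (rule CauchyI)
    fix e :: real assume e: "0 < e"
    obtain N where N: "4 / e\<^sup>2 < real N" using reals_Archimedean2 by blast
    have N0: "0 < real (Suc N)" by simp
    have NN: "4 / real (Suc N) < e\<^sup>2"
      using N e by (simp add: field_simps)
        (smt (verit) mult_pos_pos zero_less_power)
    have "norm (y m - y n) < e" if "m \<ge> N" "n \<ge> N" for m n
    proof -
      have "2 / real (Suc m) \<le> 2 / real (Suc N)" "2 / real (Suc n) \<le> 2 / real (Suc N)"
        using that by (auto intro!: divide_left_mono)
      then have "(norm (y m - y n))\<^sup>2 < e\<^sup>2" using para[of m n] NN by simp
      then show ?thesis using e by (simp add: power_less_imp_less_base)
    qed
    then show "\<exists>M. \<forall>m\<ge>M. \<forall>n\<ge>M. norm (y m - y n) < e" by blast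
  qed
  then obtain p where p: "y \<longlonglongrightarrow> p" using Cauchy_convergent convergent_def by blast
  have pS: "p \<in> S" using cl yS p closed_sequentially by blast
  have "(\<lambda>n. (norm (x - y n))\<^sup>2) \<longlonglongrightarrow> (norm (x - p))\<^sup>2" by (intro tendsto_intros p)
  moreover have "(\<lambda>n. d\<^sup>2 + 1 / real (Suc n)) \<longlonglongrightarrow> d\<^sup>2 + 0"
    by (intro tendsto_intros LIMSEQ_Suc[OF lim_1_over_n])
  ultimately have pd: "(norm (x - p))\<^sup>2 \<le> d\<^sup>2"
    using yd by (metis (no_types, lifting) LIMSEQ_le add_0_right less_imp_le)
  have orth: "z \<bullet> (x - p) = 0" if z: "z \<in> S" for z
  proof (cases "z = 0")
    case False
    define t where "t = (z \<bullet> (x - p)) / (z \<bullet> z)"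
    have zz: "z \<bullet> z > 0" using False by simp
    have "p + t *\<^sub>R z \<in> S" using sub pS z by (simp add: subspace_add subspace_scale)
    then have "(norm (x - p))\<^sup>2 \<le> (norm (x - (p + t *\<^sub>R z)))\<^sup>2" using dle2 pd order_trans by blast
    also have "\<dots> = (norm (x - p))\<^sup>2 - 2 * t * (z \<bullet> (x - p)) + t\<^sup>2 * (z \<bullet> z)"
      unfolding power2_norm_eq_inner
      by (simp add: inner_diff_left inner_diff_right inner_add_left inner_add_right
          inner_commute algebra_simps power2_eq_square)
    also have "\<dots> = (norm (x - p))\<^sup>2 - (z \<bullet> (x - p))\<^sup>2 / (z \<bullet> z)"
      using zz by (simp add: t_def field_simps power2_eq_square)
    finally have "(z \<bullet> (x - p))\<^sup>2 / (z \<bullet> z) \<le> 0" by simp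
    then show ?thesis using zz by (simp add: divide_le_0_iff)
  qed simp
  show ?thesis
  proof (rule ex1I[of _ p])
    show "p \<in> S \<and> x - p \<in> S\<^sup>\<bottom>" using pS orth by (simp add: orthogonal_comp_def orthogonal_def)
    fix q assume q: "q \<in> S \<and> x - q \<in> S\<^sup>\<bottom>"
    then have "q - p \<in> S" using sub pS by (simp add: subspace_diff)
    then have "(q - p) \<bullet> (x - p) = 0" "(q - p) \<bullet> (x - q) = 0"
      using q orth by (auto simp: orthogonal_comp_def orthogonal_def)
    then have "(q - p) \<bullet> (q - p) = 0" by (simp add: inner_diff_right)
    then show "q = p" by simp
  qed
qed

lemma closed_orthogonal_comp: "closed (S\<^sup>\<bottom>)" for S :: "'a::real_inner set"
proof -
  have "S\<^sup>\<bottom> = (\<Inter>y\<in>S. {x. y \<bullet> x = 0})" by (auto simp: orthogonal_comp_def orthogonal_def)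
  then show ?thesis by (auto intro!: closed_INT closed_Collect_eq continuous_intros)
qed

lemma tikhonov_ex1:
  fixes A :: "'v::{real_inner,complete_space} \<Rightarrow> 'h::{real_inner,complete_space}"
  assumes A: "bounded_linear A" and e: "\<epsilon> > 0"
  shows "\<exists>!u. \<forall>v. A u \<bullet> A v + \<epsilon> * (u \<bullet> v) = g \<bullet> A v"
proof -
  interpret bounded_linear A by fact
  define S where "S = {w :: 'h \<times> 'v. fst w = A ((1 / sqrt \<epsilon>) *\<^sub>R snd w)}"
  have mem: "(A v, sqrt \<epsilon> *\<^sub>R v) \<in> S" for v using e by (simp add: S_def)
  have sub: "subspace S"
    unfolding subspace_def S_def
    by (auto simp: zero add scaleR scaleR_add_right)
  have "closed S" unfolding S_def
    by (intro closed_Collect_eq continuous_intros continuous_on)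
  from orth_proj_ex1[OF sub this, of "(g, 0)"] obtain p where p: "p \<in> S" "(g, 0) - p \<in> S\<^sup>\<bottom>" by blast
  define u where "u = (1 / sqrt \<epsilon>) *\<^sub>R snd p"
  have pu: "p = (A u, sqrt \<epsilon> *\<^sub>R u)" using p(1) e by (simp add: S_def u_def prod_eq_iff)
  show ?thesis
  proof (rule ex1I[of _ u])
    show "\<forall>v. A u \<bullet> A v + \<epsilon> * (u \<bullet> v) = g \<bullet> A v"
    proof
      fix v
      have "(A v, sqrt \<epsilon> *\<^sub>R v) \<bullet> ((g, 0) - p) = 0"
        using p(2) mem[of v] by (simp add: orthogonal_comp_def orthogonal_def)
      then have "A v \<bullet> (g - A u) - sqrt \<epsilon> * sqrt \<epsilon> * (v \<bullet> u) = 0"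
        by (simp add: pu)
      then show "A u \<bullet> A v + \<epsilon> * (u \<bullet> v) = g \<bullet> A v"
        using e by (simp add: inner_diff_right inner_commute)
    qed
    fix w assume w: "\<forall>v. A w \<bullet> A v + \<epsilon> * (w \<bullet> v) = g \<bullet> A v"
    have "A (w - u) \<bullet> A (w - u) + \<epsilon> * ((w - u) \<bullet> (w - u)) = 0"
      using spec[OF w, of "w - u"] \<open>\<forall>v. A u \<bullet> A v + \<epsilon> * (u \<bullet> v) = g \<bullet> A v\<close>[rule_format, of "w - u"]
      by (simp only: diff inner_diff_left right_diff_distrib)
    then have "\<epsilon> * ((w - u) \<bullet> (w - u)) \<le> 0" using inner_ge_zero[of "A (w - u)"] by linarith
    then have "(w - u) \<bullet> (w - u) \<le> 0" using e by (simp add: mult_le_0_iff)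
    then have "(w - u) \<bullet> (w - u) = 0" using inner_ge_zero[of "w - u"] by linarith
    then show "w = u" by simp
  qed
qed

end

theory Submission
  imports Defs
begin

text \<open>
  This is Morozov's discrepancy principle. Write \<open>r \<epsilon> = \<parallel>A u\<^sub>\<epsilon> - g\<parallel>\<close> for the discrepancy. The
  solution \<open>u\<^sub>\<epsilon>\<close> minimizes \<open>\<parallel>A v - g\<parallel>\<^sup>2 + \<epsilon> \<parallel>v\<parallel>\<^sup>2\<close>, and the functional exceeds its minimum at \<open>v\<close> by
  exactly \<open>\<parallel>A (v - u\<^sub>\<epsilon>)\<parallel>\<^sup>2 + \<epsilon> \<parallel>v - u\<^sub>\<epsilon>\<parallel>\<^sup>2\<close> (\<open>tikhonov_functional_excess\<close>). Comparing the solutions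
  for two parameters \<open>a < b\<close> through this identity gives a closed formula for
  \<open>(b - a) * ((r b)\<^sup>2 - (r a)\<^sup>2)\<close> (\<open>discrepancy_two_parameters\<close>), from which everything about the
  shape of \<open>r\<close> follows:

  \<^item> \<open>r\<close> is strictly increasing as soon as \<open>g\<close> is not orthogonal to the range of \<open>A\<close>, because only
    then do different parameters have different solutions (\<open>discrepancy_strict_mono\<close>);

  \<^item> \<open>r \<epsilon> / \<epsilon>\<close> is nonincreasing (\<open>discrepancy_ratio_antimono\<close>), which bounds the growth of \<open>r\<close> and
    makes it continuous on \<open>\<epsilon> > 0\<close> (\<open>discrepancy_continuous_on\<close>).

  For large \<open>\<epsilon>\<close> the penalty forces \<open>A u\<^sub>\<epsilon>\<close> towards \<open>0\<close>, so \<open>r \<epsilon>\<close> exceeds \<open>\<delta> < \<parallel>g\<parallel>\<close>. For small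
  \<open>\<epsilon>\<close>, minimality pushes \<open>r \<epsilon>\<close> below any bound that is larger than the distance from \<open>g\<close> to the
  range of \<open>A\<close>, and that distance is the norm of the projection of \<open>g\<close> on the orthogonal complement
  of the range (\<open>diff_orth_proj_in_closure\<close>). The intermediate value theorem gives existence, and
  strict monotonicity gives uniqueness.
\<close>

abbreviation discrepancy ::
  "('v::real_inner \<Rightarrow> 'h::real_inner) \<Rightarrow> 'h \<Rightarrow> real \<Rightarrow> real" where
  "discrepancy A g \<epsilon> \<equiv> norm (A (tikhonov A g \<epsilon>) - g)"

lemma tikhonov_eq:
  fixes A :: "'v::{real_inner,complete_space} \<Rightarrow> 'h::{real_inner,complete_space}"
  assumes "bounded_linear A" and "\<epsilon> > 0"
  shows "A (tikhonov A g \<epsilon>) \<bullet> A v + \<epsilon> * (tikhonov A g \<epsilon> \<bullet> v) = g \<bullet> A v"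
  using theI'[OF tikhonov_ex1[OF assms, of g]] unfolding tikhonov_def by blast

text \<open>The functional is quadratic and the variational equation says that its first-order term at
  the solution vanishes; what remains is the quadratic part.\<close>

lemma tikhonov_functional_excess:
  fixes A :: "'v::{real_inner,complete_space} \<Rightarrow> 'h::{real_inner,complete_space}"
    and g :: 'h
  assumes A: "bounded_linear A" and e: "\<epsilon> > 0"
  defines "u \<equiv> tikhonov A g \<epsilon>"
  shows "(norm (A v - g))\<^sup>2 + \<epsilon> * (norm v)\<^sup>2
    = (norm (A u - g))\<^sup>2 + \<epsilon> * (norm u)\<^sup>2 + (norm (A (v - u)))\<^sup>2 + \<epsilon> * (norm (v - u))\<^sup>2"
proof -
  have eq: "A u \<bullet> A (v - u) + \<epsilon> * (u \<bullet> (v - u)) = g \<bullet> A (v - u)"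
    unfolding u_def by (rule tikhonov_eq[OF A e])
  have d: "A (v - u) = A v - A u"
    using A by (simp add: linear_diff bounded_linear.linear)
  show ?thesis
    using eq unfolding d power2_norm_eq_inner
    by (simp add: inner_diff_left inner_diff_right inner_commute algebra_simps)
qed

lemma discrepancy_le_functional:
  fixes A :: "'v::{real_inner,complete_space} \<Rightarrow> 'h::{real_inner,complete_space}"
  assumes A: "bounded_linear A" and e: "\<epsilon> > 0"
  shows "(discrepancy A g \<epsilon>)\<^sup>2 \<le> (norm (A v - g))\<^sup>2 + \<epsilon> * (norm v)\<^sup>2"
  using e unfolding tikhonov_functional_excess[OF A e, of v g] by simp

lemma discrepancy_le_norm:
  fixes A :: "'v::{real_inner,complete_space} \<Rightarrow> 'h::{real_inner,complete_space}"
  assumes A: "bounded_linear A" and e: "\<epsilon> > 0"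
  shows "discrepancy A g \<epsilon> \<le> norm g"
proof -
  have "A 0 = 0" using A by (simp add: linear_0 bounded_linear.linear)
  then have "(discrepancy A g \<epsilon>)\<^sup>2 \<le> (norm g)\<^sup>2"
    using discrepancy_le_functional[OF A e, of g 0] by simp
  then show ?thesis by (rule power2_le_imp_le) simp
qed

text \<open>Evaluate the functional for \<open>a\<close> at the solution for \<open>b\<close> and conversely; in the combination
  with weights \<open>b\<close> and \<open>a\<close> the norms of the solutions cancel.\<close>

lemma discrepancy_two_parameters:
  fixes A :: "'v::{real_inner,complete_space} \<Rightarrow> 'h::{real_inner,complete_space}"
    and g :: 'h
  assumes A: "bounded_linear A" and a: "a > 0" and b: "b > 0"
  defines "w \<equiv> tikhonov A g b - tikhonov A g a"
  shows "(b - a) * ((discrepancy A g b)\<^sup>2 - (discrepancy A g a)\<^sup>2)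
    = (a + b) * (norm (A w))\<^sup>2 + 2 * a * b * (norm w)\<^sup>2"
proof -
  define u where "u = tikhonov A g a"
  define v where "v = tikhonov A g b"
  have "u - v = - w" by (simp add: u_def v_def w_def)
  then have neg: "norm (A (u - v)) = norm (A w)" "norm (u - v) = norm w"
    using A by (simp_all add: linear_neg bounded_linear.linear)
  have "(norm (A v - g))\<^sup>2 + a * (norm v)\<^sup>2
    = (norm (A u - g))\<^sup>2 + a * (norm u)\<^sup>2 + (norm (A w))\<^sup>2 + a * (norm w)\<^sup>2"
    using tikhonov_functional_excess[OF A a, of v g] by (simp add: u_def v_def w_def)
  moreover have "(norm (A u - g))\<^sup>2 + b * (norm u)\<^sup>2
    = (norm (A v - g))\<^sup>2 + b * (norm v)\<^sup>2 + (norm (A w))\<^sup>2 + b * (norm w)\<^sup>2"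
    using tikhonov_functional_excess[OF A b, of u g] neg by (simp add: v_def)
  ultimately have "(b - a) * ((norm (A v - g))\<^sup>2 - (norm (A u - g))\<^sup>2)
    = (a + b) * (norm (A w))\<^sup>2 + 2 * a * b * (norm w)\<^sup>2"
    by algebra
  then show ?thesis by (simp add: u_def v_def)
qed

lemma discrepancy_mono:
  fixes A :: "'v::{real_inner,complete_space} \<Rightarrow> 'h::{real_inner,complete_space}"
  assumes A: "bounded_linear A" and a: "0 < a" and ab: "a \<le> b"
  shows "discrepancy A g a \<le> discrepancy A g b"
proof (cases "a = b")
  case False
  have "0 \<le> (b - a) * ((discrepancy A g b)\<^sup>2 - (discrepancy A g a)\<^sup>2)"
    using a ab by (subst discrepancy_two_parameters[OF A]) auto
  with False ab have "(discrepancy A g a)\<^sup>2 \<le> (discrepancy A g b)\<^sup>2"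
    by (simp add: zero_le_mult_iff)
  then show ?thesis by (rule power2_le_imp_le) simp
qed simp

text \<open>Solutions for two different parameters can only coincide if they vanish, and the zero solution
  means that \<open>g\<close> is orthogonal to the range.\<close>

lemma discrepancy_strict_mono:
  fixes A :: "'v::{real_inner,complete_space} \<Rightarrow> 'h::{real_inner,complete_space}"
  assumes A: "bounded_linear A" and g: "g \<notin> (range A)\<^sup>\<bottom>" and a: "0 < a" and ab: "a < b"
  shows "discrepancy A g a < discrepancy A g b"
proof -
  have b: "0 < b" using a ab by simp
  have "tikhonov A g b \<noteq> tikhonov A g a"
  proof
    assume same: "tikhonov A g b = tikhonov A g a"
    define u where "u = tikhonov A g a"
    have ua: "A u \<bullet> A v + a * (u \<bullet> v) = g \<bullet> A v" for v
      unfolding u_def by (rule tikhonov_eq[OF A a])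
    have ub: "A u \<bullet> A v + b * (u \<bullet> v) = g \<bullet> A v" for v
      unfolding u_def same[symmetric] by (rule tikhonov_eq[OF A b])
    have "(b - a) * (u \<bullet> u) = 0" using ua[of u] ub[of u] unfolding left_diff_distrib by linarith
    then have "u = 0" using ab by simp
    moreover have "A 0 = 0" using A by (simp add: linear_0 bounded_linear.linear)
    ultimately have "g \<bullet> A v = 0" for v using ua[of v] by simp
    then have "g \<in> (range A)\<^sup>\<bottom>"
      by (auto simp: orthogonal_comp_def orthogonal_def inner_commute)
    then show False using g by contradiction
  qed
  then have "0 < 2 * a * b * (norm (tikhonov A g b - tikhonov A g a))\<^sup>2"
    using a b by simp
  then have "0 < (b - a) * ((discrepancy A g b)\<^sup>2 - (discrepancy A g a)\<^sup>2)"
    using a b by (subst discrepancy_two_parameters[OF A a b]) (simp add: add_nonneg_pos)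
  then have "(discrepancy A g a)\<^sup>2 < (discrepancy A g b)\<^sup>2"
    using ab by (simp add: zero_less_mult_iff)
  then show ?thesis by (rule power_less_imp_less_base) simp
qed

text \<open>The increment of the discrepancy is at most the norm of \<open>A (u\<^sub>b - u\<^sub>a)\<close>, whose square is
  controlled by the two-parameter identity. Dividing by the increment leaves a linear inequality
  between the two discrepancies.\<close>

lemma discrepancy_ratio_antimono:
  fixes A :: "'v::{real_inner,complete_space} \<Rightarrow> 'h::{real_inner,complete_space}"
  assumes A: "bounded_linear A" and a: "0 < a" and ab: "a \<le> b"
  shows "discrepancy A g b / b \<le> discrepancy A g a / a"
proof -
  define r where "r = discrepancy A g a"
  define s where "s = discrepancy A g b"
  define w where "w = tikhonov A g b - tikhonov A g a"
  have b: "0 < b" using a ab by simp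
  have rs: "r \<le> s" unfolding r_def s_def by (rule discrepancy_mono[OF A a ab])
  have "a * s \<le> b * r"
  proof (cases "r = s")
    case True
    then show ?thesis using ab by (simp add: mult_right_mono s_def)
  next
    case False
    have "A w = (A (tikhonov A g b) - g) - (A (tikhonov A g a) - g)"
      using A by (simp add: w_def linear_diff bounded_linear.linear)
    then have "s - r \<le> norm (A w)"
      unfolding r_def s_def using norm_triangle_ineq2 by metis
    then have "(s - r)\<^sup>2 \<le> (norm (A w))\<^sup>2" using rs by (intro power_mono) auto
    then have "(a + b) * (s - r)\<^sup>2 \<le> (a + b) * (norm (A w))\<^sup>2 + 2 * a * b * (norm w)\<^sup>2"
      using a b by (intro add_increasing2 mult_left_mono) auto
    also have "\<dots> = (b - a) * (s\<^sup>2 - r\<^sup>2)"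
      unfolding r_def s_def w_def by (rule discrepancy_two_parameters[OF A a b, symmetric])
    finally have "(s - r) * ((a + b) * (s - r)) \<le> (s - r) * ((b - a) * (s + r))"
      by (simp add: power2_eq_square algebra_simps)
    then have "(a + b) * (s - r) \<le> (b - a) * (s + r)"
      using False rs by (simp add: mult_le_cancel_left)
    then show ?thesis by (simp add: algebra_simps)
  qed
  then show ?thesis
    using a b by (simp add: r_def s_def field_simps)
qed

text \<open>Monotonicity bounds the increment from below and the nonincreasing ratio bounds it from above,
  so the discrepancy is Lipschitz away from zero.\<close>

lemma discrepancy_continuous_on:
  fixes A :: "'v::{real_inner,complete_space} \<Rightarrow> 'h::{real_inner,complete_space}"
  assumes A: "bounded_linear A" and c: "0 < c"
  shows "continuous_on {c..} (discrepancy A g)"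
proof -
  have step: "\<bar>discrepancy A g y - discrepancy A g x\<bar> \<le> norm g / c * \<bar>y - x\<bar>"
    if x: "c \<le> x" and xy: "x \<le> y" for x y
  proof -
    define r where "r = discrepancy A g x"
    have x0: "0 < x" using c x by simp
    have mono: "r \<le> discrepancy A g y"
      unfolding r_def by (rule discrepancy_mono[OF A x0 xy])
    have "discrepancy A g y \<le> y * (r / x)"
      using discrepancy_ratio_antimono[OF A x0 xy, of g] x0 xy
      by (simp add: r_def field_simps)
    then have "discrepancy A g y - r \<le> r / x * (y - x)"
      using x0 by (simp add: field_simps)
    also have "\<dots> \<le> norm g / c * (y - x)"
      using discrepancy_le_norm[OF A x0, of g] c x xy
      by (intro mult_right_mono frac_le) (auto simp: r_def)
    finally show ?thesis using mono xy by (simp add: r_def)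
  qed
  have "(norm g / c)-lipschitz_on {c..} (discrepancy A g)"
  proof (rule lipschitz_onI)
    fix x y assume "x \<in> {c..}" "y \<in> {c..}"
    then show "dist (discrepancy A g x) (discrepancy A g y) \<le> norm g / c * dist x y"
      using step[of x y] step[of y x]
      by (cases "x \<le> y") (auto simp: dist_real_def abs_minus_commute)
  qed (use c in simp)
  then show ?thesis by (rule lipschitz_on_continuous_on)
qed

text \<open>Testing the equation with the solution itself gives \<open>\<epsilon> \<parallel>u\<^sub>\<epsilon>\<parallel>\<^sup>2 \<le> \<parallel>g\<parallel> \<parallel>A u\<^sub>\<epsilon>\<parallel>\<close>, so the norm of \<open>A u\<^sub>\<epsilon>\<close> is
  at most of order \<open>1 / \<epsilon>\<close>.\<close>

lemma discrepancy_exceeds: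
  fixes A :: "'v::{real_inner,complete_space} \<Rightarrow> 'h::{real_inner,complete_space}"
  assumes A: "bounded_linear A" and d: "d < norm g"
  shows "\<exists>E>0. \<forall>\<epsilon>\<ge>E. d < discrepancy A g \<epsilon>"
proof -
  obtain K where K: "0 < K" "\<And>x. norm (A x) \<le> norm x * K"
    using bounded_linear.pos_bounded[OF A] by blast
  define M where "M = norm g * K\<^sup>2"
  define E where "E = (M + 1) / (norm g - d)"
  have M: "0 \<le> M" by (simp add: M_def)
  have E: "0 < E" using M d by (simp add: E_def)
  have "d < discrepancy A g \<epsilon>" if eE: "E \<le> \<epsilon>" for \<epsilon>
  proof -
    define u where "u = tikhonov A g \<epsilon>"
    have e: "0 < \<epsilon>" using E eE by simp
    have "A u \<bullet> A u + \<epsilon> * (u \<bullet> u) = g \<bullet> A u"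
      unfolding u_def by (rule tikhonov_eq[OF A e])
    then have "\<epsilon> * (norm u)\<^sup>2 \<le> g \<bullet> A u"
      using inner_ge_zero[of "A u"] unfolding power2_norm_eq_inner by linarith
    also have "\<dots> \<le> norm g * norm (A u)" by (rule norm_cauchy_schwarz)
    also have "\<dots> \<le> norm g * (norm u * K)" by (intro mult_left_mono K) simp
    finally have "norm u * (\<epsilon> * norm u) \<le> norm u * (norm g * K)"
      by (simp add: power2_eq_square algebra_simps)
    then have "\<epsilon> * norm u \<le> norm g * K"
      using K by (cases "u = 0") auto
    then have "\<epsilon> * norm u * K \<le> norm g * K * K" using K by (intro mult_right_mono) auto
    moreover have "\<epsilon> * norm (A u) \<le> \<epsilon> * (norm u * K)" using e by (intro mult_left_mono K) simp
    ultimately have Au: "\<epsilon> * norm (A u) \<le> M"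
      by (simp add: M_def power2_eq_square mult.assoc)
    have "M < E * (norm g - d)" using d by (simp add: E_def)
    also have "\<dots> \<le> \<epsilon> * (norm g - d)" using eE d by (intro mult_right_mono) auto
    finally have "\<epsilon> * norm (A u) < \<epsilon> * (norm g - d)" using Au by simp
    then have "norm (A u) < norm g - d" using e by simp
    moreover have "norm g - norm (A u) \<le> norm (A u - g)"
      using norm_triangle_ineq2[of g "A u"] by (simp add: norm_minus_commute)
    ultimately show ?thesis by (simp add: u_def)
  qed
  then show ?thesis using E by blast
qed

text \<open>If \<open>A v\<close> is closer to \<open>g\<close> than \<open>d\<close>, then minimality against the fixed competitor \<open>v\<close> suffices
  once the penalty \<open>\<epsilon> \<parallel>v\<parallel>\<^sup>2\<close> is small.\<close>

lemma discrepancy_below: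
  fixes A :: "'v::{real_inner,complete_space} \<Rightarrow> 'h::{real_inner,complete_space}"
  assumes A: "bounded_linear A" and v: "norm (A v - g) < d"
  shows "\<exists>e>0. discrepancy A g e < d"
proof -
  define q where "q = d\<^sup>2 - (norm (A v - g))\<^sup>2"
  define e where "e = q / ((norm v)\<^sup>2 + 1)"
  have d: "0 < d" using v norm_ge_zero by (rule le_less_trans[rotated])
  have q: "0 < q" using v by (simp add: q_def power_strict_mono)
  have n: "0 < (norm v)\<^sup>2 + 1" by (simp add: add_nonneg_pos)
  have e: "0 < e" using q n by (simp add: e_def)
  have "e * ((norm v)\<^sup>2 + 1) = q" using n by (simp add: e_def)
  then have "e * (norm v)\<^sup>2 < q" using e by (simp add: algebra_simps)
  then have "(discrepancy A g e)\<^sup>2 < d\<^sup>2"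
    using discrepancy_le_functional[OF A e, of g v] by (simp add: q_def)
  then have "discrepancy A g e < d" by (rule power_less_imp_less_base) (use d in simp)
  then show ?thesis using e by blast
qed

lemma subspace_closure:
  fixes S :: "'a::real_normed_vector set"
  assumes S: "subspace S"
  shows "subspace (closure S)"
proof (rule subspaceI)
  show "0 \<in> closure S" using subspace_0[OF S] closure_subset by blast
next
  fix x y assume "x \<in> closure S" "y \<in> closure S"
  then obtain f h where "\<And>n. f n \<in> S" "f \<longlonglongrightarrow> x" "\<And>n. h n \<in> S" "h \<longlonglongrightarrow> y"
    unfolding closure_sequential by blast
  then show "x + y \<in> closure S" unfolding closure_sequential
    by (intro exI[of _ "\<lambda>n. f n + h n"]) (auto intro: subspace_add[OF S] tendsto_add)
next
  fix c x assume "x \<in> closure S"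
  then obtain f where "\<And>n. f n \<in> S" "f \<longlonglongrightarrow> x"
    unfolding closure_sequential by blast
  then show "c *\<^sub>R x \<in> closure S" unfolding closure_sequential
    by (intro exI[of _ "\<lambda>n. c *\<^sub>R f n"]) (auto intro: subspace_scale[OF S] tendsto_scaleR)
qed

lemma orth_proj_eq:
  fixes S :: "'a::{real_inner,complete_space} set"
  assumes "subspace S" "closed S" "p \<in> S" "x - p \<in> S\<^sup>\<bottom>"
  shows "orth_proj S x = p"
  unfolding orth_proj_def using orth_proj_ex1[OF assms(1,2), of x] assms(3,4)
  by (intro the1_equality) auto

text \<open>Projecting on the closure \<open>C\<close> of \<open>S\<close> splits \<open>x\<close> into a part in \<open>C\<close> and a part orthogonal to
  \<open>S\<close>. As \<open>C\<close> lies in the double complement of \<open>S\<close>, the second part is the projection on the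
  complement.\<close>

lemma diff_orth_proj_in_closure:
  fixes S :: "'a::{real_inner,complete_space} set"
  assumes S: "subspace S"
  shows "x - orth_proj (S\<^sup>\<bottom>) x \<in> closure S"
proof -
  have "subspace (closure S)" using S by (rule subspace_closure)
  then obtain q where q: "q \<in> closure S" "x - q \<in> (closure S)\<^sup>\<bottom>"
    using orth_proj_ex1[of "closure S" x] by auto
  have sub: "S \<subseteq> (S\<^sup>\<bottom>)\<^sup>\<bottom>"
    by (auto simp: orthogonal_comp_def orthogonal_def inner_commute)
  have "closure S \<subseteq> (S\<^sup>\<bottom>)\<^sup>\<bottom>" by (rule closure_minimal[OF sub closed_orthogonal_comp])
  then have "x - (x - q) \<in> (S\<^sup>\<bottom>)\<^sup>\<bottom>" using q(1) by auto
  moreover have "x - q \<in> S\<^sup>\<bottom>"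
    using q(2) closure_subset[of S] by (auto simp: orthogonal_comp_def)
  ultimately have "orth_proj (S\<^sup>\<bottom>) x = x - q"
    by (intro orth_proj_eq subspace_orthogonal_comp closed_orthogonal_comp)
  then show ?thesis using q(1) by simp
qed

theorem theorem2p1:
  fixes A :: "'v::{real_inner,complete_space} \<Rightarrow> 'h::{real_inner,complete_space}"
    and g :: 'h and \<delta> :: real
  assumes "bounded_linear A" and "inj A"
    and "\<delta> > 0"
    and "norm (orth_proj ((range A)\<^sup>\<bottom>) g) < \<delta>" and "\<delta> < norm g"
  shows "\<exists>!\<epsilon>. \<epsilon> > 0 \<and> norm (A (tikhonov A g \<epsilon>) - g) = \<delta>"
proof -
  note A = assms(1)
  define p where "p = orth_proj ((range A)\<^sup>\<bottom>) g"
  have p: "norm p < \<delta>" using assms(4) by (simp add: p_def)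
  have range: "subspace (range A)"
    using A by (simp add: bounded_linear.linear linear_subspace_image)
  have "g - p \<in> closure (range A)"
    unfolding p_def by (rule diff_orth_proj_in_closure[OF range])
  then obtain v where "dist (A v) (g - p) < \<delta> - norm p"
    using p by (auto simp: closure_approachable dest: spec[of _ "\<delta> - norm p"])
  then have "norm (A v - g) < \<delta>"
    using norm_triangle_ineq4[of "A v - (g - p)" p] by (simp add: dist_norm)
  then obtain a where a: "0 < a" "discrepancy A g a < \<delta>"
    using discrepancy_below[OF A] by blast
  obtain E where E: "\<And>\<epsilon>. E \<le> \<epsilon> \<Longrightarrow> \<delta> < discrepancy A g \<epsilon>"
    using discrepancy_exceeds[OF A assms(5)] by blast
  define b where "b = max a E"
  have b: "a \<le> b" "\<delta> < discrepancy A g b" using E[of b] by (auto simp: b_def)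
  have "continuous_on {a..b} (discrepancy A g)"
    using discrepancy_continuous_on[OF A a(1)] by (rule continuous_on_subset) auto
  then obtain e where e: "a \<le> e" "discrepancy A g e = \<delta>"
    using IVT'[of "discrepancy A g" a \<delta> b] a b by auto
  \<comment> \<open>If \<open>g\<close> were orthogonal to the range, it would be its own projection, of norm larger than \<open>\<delta>\<close>.\<close>
  have g: "g \<notin> (range A)\<^sup>\<bottom>"
  proof
    assume "g \<in> (range A)\<^sup>\<bottom>"
    then have "p = g" unfolding p_def
      by (intro orth_proj_eq subspace_orthogonal_comp closed_orthogonal_comp)
        (auto simp: orthogonal_comp_def orthogonal_def)
    then show False using p assms(5) by simp
  qed
  show ?thesis
  proof (rule ex1I[of _ e])
    show "e > 0 \<and> discrepancy A g e = \<delta>" using a e by simp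
    fix x assume x: "x > 0 \<and> discrepancy A g x = \<delta>"
    then show "x = e"
      using discrepancy_strict_mono[OF A g, of x e] discrepancy_strict_mono[OF A g, of e x] a e
      by (cases x e rule: linorder_cases) auto
  qed
qed

end
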